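(* Consider a water distribution system (WDS), with given pump speeds and given reference pressure $h_r$ at node $r$, and let $\mathbf{d}\in\mathbb{R}^N$ be a given vector of water injections. If the water flow (WF) equations are feasible for $\mathbf{d}$ (i.e., there exists at least one pair $(\mathbf{f},\mathbf{h})\in\mathbb{R}^P\times\mathbb{R}^N$ satisfying them), then they have a unique solution $(\mathbf{f},\mathbf{h})$.
   Context: A water distribution system (WDS) is a finite connected directed graph $\mathcal{G}=(\mathcal{N},\mathcal{P})$ with $\mathcal{N}=\{1,\dots,N\}$ and $P=|\mathcal{P}|$; the direction of an edge is only a reference direction for its flow. The edge set is partitioned into pumps $\mathcal{P}_a\subset\mathcal{P}$ and lossy pipes $\bar{\mathcal{P}}_a=\mathcal{P}\setminus\mathcal{P}_a$. The edge-node incidence matrix $\mathbf{A}\in\mathbb{R}^{P\times N}$ has, for each edge $p=(m,n)$, entries $A_{p,m}=+1$, $A_{p,n}=-1$ and $A_{p,k}=0$ for the other $k$. Vectors: injections $\mathbf{d}\in\mathbb{R}^N$, flows $\mathbf{f}\in\mathbb{R}^P$ (with $f_{mn}$ the flow on edge $(m,n)$, possibly negative on lossy pipes), pressures $\mathbf{h}\in\mathbb{R}^N$. A reference node $r\in\mathcal{N}$ has given pressure $h_r$. The WF equations are: (i) $\mathbf{A}^\top\mathbf{f}=\mathbf{d}$; (ii) for every lossy pipe $(m,n)\in\bar{\mathcal{P}}_a$: $h_m-h_n=c_{mn}\,\mathrm{sign}(f_{mn})f_{mn}^2$, where $c_{mn}>0$ is a constant and $\mathrm{sign}(0)=0$;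 (iii) for every pump $(m,n)\in\mathcal{P}_a$: $h_n-h_m=\lambda_{mn}f_{mn}^2+\bar\mu_{mn}f_{mn}+\bar\nu_{mn}$, with flow in the operating range $0\le\underline{f}_{mn}\le f_{mn}\le\bar f_{mn}$. The $r$-th entry of $\mathbf{h}$ must equal the given $h_r$. The unknowns are $\mathbf{f}$ and $\mathbf{h}$. Pump parameters: $\lambda_{mn}<0$, $\bar\mu_{mn}=\mu_{mn}\omega^0_{mn}$, $\bar\nu_{mn}=\nu_{mn}(\omega^0_{mn})^2$, where $\mu_{mn},\nu_{mn}\ge0$ are known constants and $\omega^0_{mn}$ is the given pump speed; they satisfy $2\lambda_{mn}\underline{f}_{mn}+\bar\mu_{mn}<0$, so that the pressure gain is strictly decreasing in $f_{mn}$ on $[\underline{f}_{mn},\bar f_{mn}]$. All pumps in $\mathcal{P}_a$ are running (a pump that is off is removed by merging its end nodes, or treated as a lossy pipe). *)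

theory Defs
  imports Complex_Main "HOL-Library.FuncSet" "Graph_Theory.Graph_Theory"
begin

text \<open>
  An edge is the ordered pair of its end nodes, so a quantity written with the double
  index mn is a function applied to the pair \<open>(m, n)\<close>.  Of the per-edge parameters,
  \<open>loss\<close> (the constant c) is meaningful on lossy pipes only, and all those after it on
  pumps only.
\<close>

record wds =
  network :: "nat pair_pre_digraph"
  pumps :: "(nat \<times> nat) set"
  loss :: "nat \<times> nat \<Rightarrow> real"
  lam :: "nat \<times> nat \<Rightarrow> real"
  mu :: "nat \<times> nat \<Rightarrow> real"
  nu :: "nat \<times> nat \<Rightarrow> real"
  fmin :: "nat \<times> nat \<Rightarrow> real"
  fmax :: "nat \<times> nat \<Rightarrow> real"

abbreviation nodes :: "wds \<Rightarrow> nat set" where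
  "nodes W \<equiv> pverts (network W)"

abbreviation edges :: "wds \<Rightarrow> (nat \<times> nat) set" where
  "edges W \<equiv> parcs (network W)"

definition lossy_pipes :: "wds \<Rightarrow> (nat \<times> nat) set" where
  "lossy_pipes W = edges W - pumps W"

text \<open>
  \<open>pair_digraph\<close> means finite and without self-loops (which the definition of the incidence
  matrix excludes); \<open>Digraph_Component.connected\<close> ignores the direction of the edges.
\<close>

definition is_wds :: "wds \<Rightarrow> bool" where
  "is_wds W \<longleftrightarrow>
     pair_digraph (network W) \<and>
     Digraph_Component.connected (with_proj (network W)) \<and>
     (\<exists>N. nodes W = {1..N}) \<and>
     pumps W \<subseteq> edges W \<and>
     (\<forall>e \<in> lossy_pipes W. loss W e > 0) \<and>
     (\<forall>e \<in> pumps W. lam W e < 0 \<and> mu W e \<ge> 0 \<and> nu W e \<ge> 0 \<and>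
        0 \<le> fmin W e \<and> fmin W e \<le> fmax W e)"

definition mu_bar :: "wds \<Rightarrow> (nat \<times> nat \<Rightarrow> real) \<Rightarrow> nat \<times> nat \<Rightarrow> real" where
  "mu_bar W \<omega> e = mu W e * \<omega> e"

definition nu_bar :: "wds \<Rightarrow> (nat \<times> nat \<Rightarrow> real) \<Rightarrow> nat \<times> nat \<Rightarrow> real" where
  "nu_bar W \<omega> e = nu W e * (\<omega> e)\<^sup>2"

text \<open>
  Given the sign of \<open>lam\<close>, this says that the derivative of the pressure gain
  \<open>lam * f\<^sup>2 + mu_bar * f + nu_bar\<close> is negative for all flows \<open>f \<ge> fmin\<close>.
\<close>

definition speeds_ok :: "wds \<Rightarrow> (nat \<times> nat \<Rightarrow> real) \<Rightarrow> bool" where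
  "speeds_ok W \<omega> \<longleftrightarrow> (\<forall>e \<in> pumps W. 2 * lam W e * fmin W e + mu_bar W \<omega> e < 0)"

definition incidence :: "nat \<times> nat \<Rightarrow> nat \<Rightarrow> real" where
  "incidence e k = (if k = fst e then 1 else if k = snd e then - 1 else 0)"

text \<open>
  Real vectors indexed by a finite set \<open>I\<close>.  Since these functions are \<open>undefined\<close> outside
  \<open>I\<close>, equality of functions is equality of vectors.
\<close>

abbreviation real_vectors :: "'i set \<Rightarrow> ('i \<Rightarrow> real) set" where
  "real_vectors I \<equiv> I \<rightarrow>\<^sub>E (UNIV :: real set)"

definition wf_solution ::
  "wds \<Rightarrow> (nat \<times> nat \<Rightarrow> real) \<Rightarrow> nat \<Rightarrow> real \<Rightarrow> (nat \<Rightarrow> real) \<Rightarrow>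
   (nat \<times> nat \<Rightarrow> real) \<Rightarrow> (nat \<Rightarrow> real) \<Rightarrow> bool" where
  "wf_solution W \<omega> r hr d f h \<longleftrightarrow>
     f \<in> real_vectors (edges W) \<and>
     h \<in> real_vectors (nodes W) \<and>
     (\<forall>k \<in> nodes W. (\<Sum>e \<in> edges W. incidence e k * f e) = d k) \<and>
     (\<forall>(m, n) \<in> lossy_pipes W.
        h m - h n = loss W (m, n) * sgn (f (m, n)) * (f (m, n))\<^sup>2) \<and>
     (\<forall>(m, n) \<in> pumps W.
        h n - h m = lam W (m, n) * (f (m, n))\<^sup>2 + mu_bar W \<omega> (m, n) * f (m, n)
                    + nu_bar W \<omega> (m, n) \<and>
        fmin W (m, n) \<le> f (m, n) \<and> f (m, n) \<le> fmax W (m, n)) \<and>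
     h r = hr"

end

theory Submission
  imports Defs
begin

text \<open>
  The proof is the monotonicity argument for nonlinear resistive networks.  On every edge the
  pressure drop from tail to head is a function of the flow alone, and that function is strictly
  increasing over the flows the edge admits (\<open>head_loss_strict_mono\<close>): on a lossy pipe it is a
  positive multiple of \<open>x * \<bar>x\<bar>\<close>, on a pump it is the negative of a gain that falls over the
  operating range.

  Let \<open>(f, h)\<close> and \<open>(f', h')\<close> be two solutions.  The flow difference \<open>f - f'\<close> has zero divergence at
  every node, hence it is orthogonal to every vector of potential differences
  (\<open>sum_flow_times_potential_difference\<close>).  Applied to the potential \<open>h - h'\<close>, this says that
  the sum of \<open>(f e - f' e) * ((h m - h n) - (h' m - h' n))\<close> over all edges \<open>e = (m, n)\<close> is zero.
  By strict monotonicity each summand is positive where \<open>f\<close> and \<open>f'\<close> differ and zero elsewhere, so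
  the flows agree (\<open>flow_unique_of_strict_mono_drop\<close>).  Equal flows give equal pressure drops, so
  \<open>h - h'\<close> takes equal values at the two ends of every edge.  The network is connected, so \<open>h - h'\<close>
  is constant (\<open>connected_potential_constant\<close>), and the constant is zero because both solutions
  have the prescribed pressure at the reference node.
\<close>

section \<open>Flows and potentials on a finite graph\<close>

text \<open>
  The incidence matrix moves from one side of an inner product to the other by transposition, and
  its row for an edge, paired with a potential, gives the difference of the end values.
  A self-loop would break this, since \<open>incidence\<close> gives it the entry 1 rather than 0.
\<close>

lemma sum_flow_times_potential_difference:
  fixes g :: "nat \<times> nat \<Rightarrow> real" and p :: "nat \<Rightarrow> real"
  assumes "finite N" and "E \<subseteq> N \<times> N" and loopfree: "\<And>e. e \<in> E \<Longrightarrow> fst e \<noteq> snd e"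
  shows "(\<Sum>e\<in>E. g e * (p (fst e) - p (snd e))) = (\<Sum>k\<in>N. p k * (\<Sum>e\<in>E. incidence e k * g e))"
proof -
  have row: "(\<Sum>k\<in>N. p k * incidence e k) = p (fst e) - p (snd e)" if "e \<in> E" for e
  proof -
    have ends: "fst e \<in> N" "snd e \<in> N"
      using that assms(2) by auto
    have "p k * incidence e k = (if fst e = k then p k else 0) - (if snd e = k then p k else 0)"
      for k
      using loopfree[OF that] by (auto simp: incidence_def)
    then show ?thesis
      using \<open>finite N\<close> ends by (simp add: sum_subtractf)
  qed
  have "(\<Sum>k\<in>N. p k * (\<Sum>e\<in>E. incidence e k * g e)) = (\<Sum>e\<in>E. \<Sum>k\<in>N. g e * (p k * incidence e k))"
    unfolding sum_distrib_left by (subst sum.swap) (simp add: mult_ac)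
  also have "\<dots> = (\<Sum>e\<in>E. g e * (p (fst e) - p (snd e)))"
    by (simp add: row flip: sum_distrib_left)
  finally show ?thesis by simp
qed

text \<open>
  Monotonicity of the edge laws makes every term of the sum above nonnegative, while equal
  divergences make the sum vanish; strictness then forces the flows to be equal edge by edge.
  The laws are restricted to sets \<open>D e\<close> because a pump curve is decreasing only on part of the
  real line.
\<close>

lemma flow_unique_of_strict_mono_drop:
  fixes f f' :: "nat \<times> nat \<Rightarrow> real" and h h' :: "nat \<Rightarrow> real"
  assumes "finite N" and "E \<subseteq> N \<times> N" and "\<And>e. e \<in> E \<Longrightarrow> fst e \<noteq> snd e"
    and mono: "\<And>e. e \<in> E \<Longrightarrow> strict_mono_on (D e) (\<phi> e)"
    and range: "\<And>e. e \<in> E \<Longrightarrow> f e \<in> D e" "\<And>e. e \<in> E \<Longrightarrow> f' e \<in> D e"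
    and drop: "\<And>e. e \<in> E \<Longrightarrow> h (fst e) - h (snd e) = \<phi> e (f e)"
      "\<And>e. e \<in> E \<Longrightarrow> h' (fst e) - h' (snd e) = \<phi> e (f' e)"
    and div: "\<And>k. k \<in> N \<Longrightarrow> (\<Sum>e\<in>E. incidence e k * f e) = (\<Sum>e\<in>E. incidence e k * f' e)"
    and "e \<in> E"
  shows "f e = f' e"
proof (rule ccontr)
  assume neq: "f e \<noteq> f' e"
  define t where "t = (\<lambda>e. (f e - f' e) * (\<phi> e (f e) - \<phi> e (f' e)))"
  have pos: "0 < t e" if "e \<in> E" "f e \<noteq> f' e" for e
    using strict_mono_onD[OF mono[OF that(1)] range(1)[OF that(1)] range(2)[OF that(1)]]
      strict_mono_onD[OF mono[OF that(1)] range(2)[OF that(1)] range(1)[OF that(1)]] that(2)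
    by (cases "f e" "f' e" rule: linorder_cases) (simp_all add: t_def zero_less_mult_iff)
  then have nonneg: "0 \<le> t e" if "e \<in> E" for e
    using that by (cases "f e = f' e") (auto simp: t_def less_imp_le)
  have "sum t E = (\<Sum>e\<in>E. (f e - f' e) * ((h (fst e) - h' (fst e)) - (h (snd e) - h' (snd e))))"
    by (rule sum.cong) (simp_all add: t_def drop[symmetric])
  also have "\<dots> = (\<Sum>k\<in>N. (h k - h' k) * (\<Sum>e\<in>E. incidence e k * (f e - f' e)))"
    using assms(1-3) by (rule sum_flow_times_potential_difference)
  also have "\<dots> = 0"
    by (simp add: right_diff_distrib sum_subtractf div)
  finally have "sum t E = 0" .
  moreover have "0 < sum t E"
    using assms(1,2) finite_subset pos[OF \<open>e \<in> E\<close> neq] nonneg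
    by (intro sum_pos2[OF _ \<open>e \<in> E\<close>]) auto
  ultimately show False by simp
qed

text \<open>
  Connectedness ignores edge directions, so two nodes are joined by a path in the symmetric closure;
  equality across an edge is symmetric and thus propagates along that path.
\<close>

lemma connected_potential_constant:
  assumes conn: "Digraph_Component.connected G"
    and edge: "\<And>e. e \<in> arcs G \<Longrightarrow> p (tail G e) = p (head G e)"
    and "u \<in> verts G" and "v \<in> verts G"
  shows "p u = p v"
proof -
  have "(u, v) \<in> rtrancl_on (verts G) (parcs (mk_symmetric G))"
    using assms by (simp add: connected_def strongly_connected_def reachable_def)
  then show ?thesis
    by induct (auto simp: parcs_mk_symmetric edge)
qed

section \<open>The pressure drop as a function of the flow\<close>

text \<open>
  Losses are counted from tail to head, so the gain of a pump enters with a minus sign; this makes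
  the function increasing on both kinds of edges.
\<close>

definition head_loss :: "wds \<Rightarrow> (nat \<times> nat \<Rightarrow> real) \<Rightarrow> nat \<times> nat \<Rightarrow> real \<Rightarrow> real" where
  "head_loss W \<omega> e x =
     (if e \<in> pumps W then - (lam W e * x\<^sup>2 + mu_bar W \<omega> e * x + nu_bar W \<omega> e)
      else loss W e * sgn x * x\<^sup>2)"

definition admissible_flows :: "wds \<Rightarrow> nat \<times> nat \<Rightarrow> real set" where
  "admissible_flows W e = (if e \<in> pumps W then {fmin W e..fmax W e} else UNIV)"

lemma strict_mono_signed_square: "strict_mono (\<lambda>x::real. sgn x * x\<^sup>2)"
proof (rule strict_monoI)
  fix x y :: real
  assume "x < y"
  \<comment> \<open>On each half-line this is monotonicity of the square; across zero it is a comparison of signs.\<close>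
  consider "0 \<le> x" | "y \<le> 0" | "x < 0" "0 < y" by linarith
  then show "sgn x * x\<^sup>2 < sgn y * y\<^sup>2"
  proof cases
    case 1
    then show ?thesis
      using \<open>x < y\<close> power_strict_mono[of x y 2] by (auto simp: sgn_if)
  next
    case 2
    then show ?thesis
      using \<open>x < y\<close> power_strict_mono[of "- y" "- x" 2] by (auto simp: sgn_if)
  next
    case 3
    then have "- (x\<^sup>2) < y\<^sup>2"
      using zero_less_power[of y 2] zero_le_power2[of x] by linarith
    with 3 show ?thesis by (simp add: sgn_if)
  qed
qed

text \<open>
  The slope of the chord of a quadratic over \<open>[x, y]\<close> is its derivative at the midpoint.  For a
  concave quadratic this is at most the derivative at \<open>a\<close>, so a negative derivative at \<open>a\<close> makes
  it decrease from there on.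
\<close>

lemma concave_quadratic_strict_antimono:
  fixes l m n a :: real
  assumes "l < 0" and slope: "2 * l * a + m < 0" and "a \<le> x" and "x < y"
  shows "l * y\<^sup>2 + m * y + n < l * x\<^sup>2 + m * x + n"
proof -
  have "l * (x + y) \<le> l * (2 * a)"
    using assms by (intro mult_left_mono_neg) auto
  then have "l * (x + y) + m < 0"
    using slope by simp
  then have "(y - x) * (l * (x + y) + m) < 0"
    using \<open>x < y\<close> by (simp add: mult_pos_neg)
  then show ?thesis
    by (simp add: algebra_simps power2_eq_square)
qed

lemma head_loss_strict_mono:
  assumes "is_wds W" and "speeds_ok W \<omega>" and "e \<in> edges W"
  shows "strict_mono_on (admissible_flows W e) (head_loss W \<omega> e)"
proof (rule strict_mono_onI)
  fix x y
  assume range: "x \<in> admissible_flows W e" "y \<in> admissible_flows W e" and "x < y"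
  show "head_loss W \<omega> e x < head_loss W \<omega> e y"
  proof (cases "e \<in> pumps W")
    case True
    then have "lam W e < 0" "2 * lam W e * fmin W e + mu_bar W \<omega> e < 0" "fmin W e \<le> x"
      using assms range by (auto simp: is_wds_def speeds_ok_def admissible_flows_def)
    from concave_quadratic_strict_antimono[OF this \<open>x < y\<close>, of "nu_bar W \<omega> e"] True
    show ?thesis by (simp add: head_loss_def)
  next
    case False
    then have "0 < loss W e"
      using assms by (auto simp: is_wds_def lossy_pipes_def)
    with False show ?thesis
      using strict_monoD[OF strict_mono_signed_square \<open>x < y\<close>] by (simp add: head_loss_def mult.assoc)
  qed
qed

lemma wf_solution_drop:
  assumes "wf_solution W \<omega> r hr d f h" and "e \<in> edges W"
  shows "h (fst e) - h (snd e) = head_loss W \<omega> e (f e)" and "f e \<in> admissible_flows W e"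
  using assms
  by (cases e; fastforce simp: wf_solution_def head_loss_def admissible_flows_def lossy_pipes_def)+

section \<open>Uniqueness of the solution\<close>

lemma wf_solution_unique:
  assumes W: "is_wds W" "speeds_ok W \<omega>" and "r \<in> nodes W"
    and sol: "wf_solution W \<omega> r hr d f h" and sol': "wf_solution W \<omega> r hr d f' h'"
  shows "f = f'" and "h = h'"
proof -
  interpret pair_digraph "network W"
    using W by (simp add: is_wds_def)
  have f_eq: "f e = f' e" if "e \<in> edges W" for e
  proof (rule flow_unique_of_strict_mono_drop[where N = "nodes W" and E = "edges W" and
        D = "admissible_flows W" and \<phi> = "head_loss W \<omega>" and f = f and f' = f' and h = h and h' = h'])
    show "edges W \<subseteq> nodes W \<times> nodes W"
      by (auto dest: wellformed')
    show "strict_mono_on (admissible_flows W e) (head_loss W \<omega> e)" if "e \<in> edges W" for e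
      using W that by (rule head_loss_strict_mono)
    show "(\<Sum>e\<in>edges W. incidence e k * f e) = (\<Sum>e\<in>edges W. incidence e k * f' e)"
      if "k \<in> nodes W" for k
      using sol sol' that by (simp add: wf_solution_def)
  qed (fact that pair_finite_verts pair_no_loops wf_solution_drop[OF sol]
         wf_solution_drop[OF sol'])+
  moreover have "f \<in> real_vectors (edges W)" "f' \<in> real_vectors (edges W)"
    using sol sol' by (simp_all add: wf_solution_def)
  ultimately show "f = f'"
    by (metis PiE_ext)
  have "h k = h' k" if "k \<in> nodes W" for k
  proof -
    have "h k - h' k = h r - h' r"
    proof (rule connected_potential_constant[where p = "\<lambda>k. h k - h' k"])
      show "Digraph_Component.connected (with_proj (network W))"
        using W by (simp add: is_wds_def)
      show "h (tail (network W) e) - h' (tail (network W) e) =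
            h (head (network W) e) - h' (head (network W) e)" if "e \<in> arcs (network W)" for e
        using that wf_solution_drop(1)[OF sol, of e] wf_solution_drop(1)[OF sol', of e] f_eq[of e]
        by simp
    qed (use that \<open>r \<in> nodes W\<close> in simp_all)
    then show ?thesis
      using sol sol' by (simp add: wf_solution_def)
  qed
  moreover have "h \<in> real_vectors (nodes W)" "h' \<in> real_vectors (nodes W)"
    using sol sol' by (simp_all add: wf_solution_def)
  ultimately show "h = h'"
    by (metis PiE_ext)
qed

theorem theorem1:
  fixes W :: wds and \<omega> :: "nat \<times> nat \<Rightarrow> real"
    and r :: nat and hr :: real and d :: "nat \<Rightarrow> real"
  assumes "is_wds W"
    and "speeds_ok W \<omega>"
    and "r \<in> nodes W"
    and "d \<in> real_vectors (nodes W)"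
    and "\<exists>f h. wf_solution W \<omega> r hr d f h"
  shows "\<exists>!(f, h). wf_solution W \<omega> r hr d f h"
proof -
  obtain f h where "wf_solution W \<omega> r hr d f h"
    using assms(5) by blast
  then show ?thesis
    using wf_solution_unique[OF assms(1-3)] by (intro ex1I[of _ "(f, h)"]) auto
qed

end
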